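(* For every formula $\varphi\in\mathcal{L}$: if $\vdash\varphi$, then $\models\varphi$.
   Context: Fix a countable set $\mathcal{AP}$ of atomic propositions. A weighted transition system (WTS) is a triple $\mathcal{M}=(S,\rightarrow,\ell)$ where $S$ is a non-empty set of states, $\rightarrow\subseteq S\times\mathbb{R}_{\ge 0}\times S$ is a transition relation (write $s\xrightarrow{r}t$), and $\ell:S\to 2^{\mathcal{AP}}$ is a labeling. For $s\in S$, $T\subseteq S$ let $\theta(s)(T)=\{r\mid \exists t\in T,\ s\xrightarrow{r}t\}$; $\theta^-(s)(T)=-\infty$ if $\theta(s)(T)=\emptyset$, else $\inf\theta(s)(T)$; $\theta^+(s)(T)=\infty$ if $\theta(s)(T)=\emptyset$, else $\sup\theta(s)(T)$. Formulae of $\mathcal{L}$: $\varphi::= p\mid\neg\varphi\mid\varphi\wedge\varphi\mid L_r\varphi\mid M_r\varphi$ with $p\in\mathcal{AP}$, $r\in\mathbb{Q}_{\ge0}$; $\bot,\vee,\to,\leftrightarrow$ defined as usual. Semantics: $\mathcal{M},s\models p$ iff $p\in\ell(s)$; Boolean cases as usual; $\mathcal{M},s\models L_r\varphi$ iff $\theta^-(s)([\![\varphi]\!])\ge r$; $\mathcal{M},s\models M_r\varphi$ iff $\theta^+(s)([\![\varphi]\!])\le r$, where $[\![\varphi]\!]$ is the set of states satisfying $\varphi$. $\models\varphi$ means $\neg\varphi$ is not satisfiable, i.e. $\varphi$ holds at every state of every WTS. Axiomatic system: $\vdash\varphi$ means $\varphi$ belongs to the smallest set of formulae containing all instances of propositional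 tautologies and of the axioms below, closed under modus ponens and the rules below (all $r,q\in\mathbb{Q}_{\ge0}$): (A1) $\neg L_0\bot$; (A2) $L_{r+q}\varphi\to L_r\varphi$ if $q>0$; (A2$'$) $M_r\varphi\to M_{r+q}\varphi$ if $q>0$; (A3) $L_r\varphi\wedge L_q\psi\to L_{\min\{r,q\}}(\varphi\vee\psi)$; (A3$'$) $M_r\varphi\wedge M_q\psi\to M_{\max\{r,q\}}(\varphi\vee\psi)$; (A4) $L_r(\varphi\vee\psi)\to L_r\varphi\vee L_r\psi$; (A5) $\neg L_0\psi\to(L_r\varphi\to L_r(\varphi\vee\psi))$; (A5$'$) $\neg L_0\psi\to(M_r\varphi\to M_r(\varphi\vee\psi))$; (A6) $L_{r+q}\varphi\to\neg M_r\varphi$ if $q>0$; (A7) $M_r\varphi\to L_0\varphi$; (R1) from $\vdash\varphi\to\psi$ infer $\vdash(L_r\psi\wedge L_0\varphi)\to L_r\varphi$; (R1$'$) from $\vdash\varphi\to\psi$ infer $\vdash(M_r\psi\wedge L_0\varphi)\to M_r\varphi$; (R2) from $\vdash\varphi\to\psi$ infer $\vdash L_0\varphi\to L_0\psi$. *)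

theory Defs
  imports "HOL-Library.Extended_Real"
begin

typedef nnrat = "{r :: rat. 0 \<le> r}"
  morphisms rat_of_nnrat Abs_nnrat
  by auto

setup_lifting type_definition_nnrat

instantiation nnrat :: "{comm_monoid_add, linorder}"
begin

lift_definition zero_nnrat :: nnrat is 0
  by simp

lift_definition plus_nnrat :: "nnrat \<Rightarrow> nnrat \<Rightarrow> nnrat" is "(+)"
  by simp

lift_definition less_eq_nnrat :: "nnrat \<Rightarrow> nnrat \<Rightarrow> bool" is "(\<le>)" .

lift_definition less_nnrat :: "nnrat \<Rightarrow> nnrat \<Rightarrow> bool" is "(<)" .

instance
  by standard (transfer; auto)+

end

definition ereal_of_nnrat :: "nnrat \<Rightarrow> ereal" where
  "ereal_of_nnrat r = ereal (of_rat (rat_of_nnrat r))"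

record ('s, 'p) wts =
  states :: "'s set"
  transitions :: "('s \<times> real \<times> 's) set"
  labelling :: "'s \<Rightarrow> 'p set"

definition is_wts :: "('s, 'p) wts \<Rightarrow> bool" where
  "is_wts M \<longleftrightarrow> states M \<noteq> {} \<and> transitions M \<subseteq> states M \<times> {0..} \<times> states M"

definition theta :: "('s, 'p) wts \<Rightarrow> 's \<Rightarrow> 's set \<Rightarrow> real set" where
  "theta M s T = {r. \<exists>t\<in>T. (s, r, t) \<in> transitions M}"

text \<open>
  The value on the empty set is \<open>-\<infinity>\<close> for the lower and \<open>\<infinity>\<close> for the upper bound, which is
  the opposite of the lattice convention for \<^const>\<open>Inf\<close> and \<^const>\<open>Sup\<close> on \<^typ>\<open>ereal\<close>.
\<close>

definition theta_minus :: "('s, 'p) wts \<Rightarrow> 's \<Rightarrow> 's set \<Rightarrow> ereal" where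
  "theta_minus M s T = (if theta M s T = {} then -\<infinity> else Inf (ereal ` theta M s T))"

definition theta_plus :: "('s, 'p) wts \<Rightarrow> 's \<Rightarrow> 's set \<Rightarrow> ereal" where
  "theta_plus M s T = (if theta M s T = {} then \<infinity> else Sup (ereal ` theta M s T))"

datatype 'p form =
    Atom 'p
  | Neg "'p form"
  | Conj "'p form" "'p form"
  | L nnrat "'p form"
  | M nnrat "'p form"

text \<open>
  The grammar has no constant for falsity, so it is the contradiction \<open>p \<and> \<not> p\<close> for one fixed
  but unspecified proposition \<open>p\<close>.
\<close>

definition Bot :: "'p form" where
  "Bot = Conj (Atom undefined) (Neg (Atom undefined))"

definition Disj :: "'p form \<Rightarrow> 'p form \<Rightarrow> 'p form" where
  "Disj \<phi> \<psi> = Neg (Conj (Neg \<phi>) (Neg \<psi>))"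

definition Imp :: "'p form \<Rightarrow> 'p form \<Rightarrow> 'p form" where
  "Imp \<phi> \<psi> = Disj (Neg \<phi>) \<psi>"

primrec sat :: "('s, 'p) wts \<Rightarrow> 's \<Rightarrow> 'p form \<Rightarrow> bool" where
  "sat \<M> s (Atom p) \<longleftrightarrow> p \<in> labelling \<M> s"
| "sat \<M> s (Neg \<phi>) \<longleftrightarrow> \<not> sat \<M> s \<phi>"
| "sat \<M> s (Conj \<phi> \<psi>) \<longleftrightarrow> sat \<M> s \<phi> \<and> sat \<M> s \<psi>"
| "sat \<M> s (L r \<phi>) \<longleftrightarrow> theta_minus \<M> s {t \<in> states \<M>. sat \<M> t \<phi>} \<ge> ereal_of_nnrat r"
| "sat \<M> s (M r \<phi>) \<longleftrightarrow> theta_plus \<M> s {t \<in> states \<M>. sat \<M> t \<phi>} \<le> ereal_of_nnrat r"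

text \<open>
  HOL cannot quantify over types inside a formula, so the type from which the states are drawn is
  an explicit parameter; a statement about an arbitrary type \<open>'s\<close> covers all systems.
\<close>

definition satisfiable :: "'s itself \<Rightarrow> 'p form \<Rightarrow> bool" where
  "satisfiable _ \<phi> \<longleftrightarrow> (\<exists>(\<M> :: ('s, 'p) wts) s. is_wts \<M> \<and> s \<in> states \<M> \<and> sat \<M> s \<phi>)"

definition valid :: "'s itself \<Rightarrow> 'p form \<Rightarrow> bool" where
  "valid S \<phi> \<longleftrightarrow> \<not> satisfiable S (Neg \<phi>)"

text \<open>
  Propositional formulae over \<open>\<not>\<close>, \<open>\<and>\<close> and countably many variables; an instance of a tautology is
  obtained by uniformly replacing its variables by formulae of the logic.
\<close>

datatype prop_form =
    PVar nat
  | PNeg prop_form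
  | PConj prop_form prop_form

primrec prop_eval :: "(nat \<Rightarrow> bool) \<Rightarrow> prop_form \<Rightarrow> bool" where
  "prop_eval v (PVar i) \<longleftrightarrow> v i"
| "prop_eval v (PNeg A) \<longleftrightarrow> \<not> prop_eval v A"
| "prop_eval v (PConj A B) \<longleftrightarrow> prop_eval v A \<and> prop_eval v B"

primrec prop_subst :: "(nat \<Rightarrow> 'p form) \<Rightarrow> prop_form \<Rightarrow> 'p form" where
  "prop_subst \<sigma> (PVar i) = \<sigma> i"
| "prop_subst \<sigma> (PNeg A) = Neg (prop_subst \<sigma> A)"
| "prop_subst \<sigma> (PConj A B) = Conj (prop_subst \<sigma> A) (prop_subst \<sigma> B)"

definition tautology :: "prop_form \<Rightarrow> bool" where
  "tautology A \<longleftrightarrow> (\<forall>v. prop_eval v A)"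

inductive provable :: "'p form \<Rightarrow> bool" where
  Taut: "tautology A \<Longrightarrow> provable (prop_subst \<sigma> A)"
| A1: "provable (Neg (L 0 Bot))"
| A2: "q > 0 \<Longrightarrow> provable (Imp (L (r + q) \<phi>) (L r \<phi>))"
| A2': "q > 0 \<Longrightarrow> provable (Imp (M r \<phi>) (M (r + q) \<phi>))"
| A3: "provable (Imp (Conj (L r \<phi>) (L q \<psi>)) (L (min r q) (Disj \<phi> \<psi>)))"
| A3': "provable (Imp (Conj (M r \<phi>) (M q \<psi>)) (M (max r q) (Disj \<phi> \<psi>)))"
| A4: "provable (Imp (L r (Disj \<phi> \<psi>)) (Disj (L r \<phi>) (L r \<psi>)))"
| A5: "provable (Imp (Neg (L 0 \<psi>)) (Imp (L r \<phi>) (L r (Disj \<phi> \<psi>))))"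
| A5': "provable (Imp (Neg (L 0 \<psi>)) (Imp (M r \<phi>) (M r (Disj \<phi> \<psi>))))"
| A6: "q > 0 \<Longrightarrow> provable (Imp (L (r + q) \<phi>) (Neg (M r \<phi>)))"
| A7: "provable (Imp (M r \<phi>) (L 0 \<phi>))"
| MP: "provable (Imp \<phi> \<psi>) \<Longrightarrow> provable \<phi> \<Longrightarrow> provable \<psi>"
| R1: "provable (Imp \<phi> \<psi>) \<Longrightarrow> provable (Imp (Conj (L r \<psi>) (L 0 \<phi>)) (L r \<phi>))"
| R1': "provable (Imp \<phi> \<psi>) \<Longrightarrow> provable (Imp (Conj (M r \<psi>) (L 0 \<phi>)) (M r \<phi>))"
| R2: "provable (Imp \<phi> \<psi>) \<Longrightarrow> provable (Imp (L 0 \<phi>) (L 0 \<psi>))"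

end

theory Submission
  imports Defs
begin

text \<open>
  The conventions \<open>\<theta>\<^sup>- = -\<infinity>\<close> and \<open>\<theta>\<^sup>+ = \<infinity>\<close> on the empty set make
  \<open>L\<^sub>r \<phi>\<close> and \<open>M\<^sub>r \<phi>\<close> first-order: some transition leads to \<open>\<phi>\<close>, and every such transition has
  weight at least (at most) \<open>r\<close>. Since weights are non-negative, \<open>L\<^sub>0 \<phi>\<close> says just that some
  transition leads to \<open>\<phi>\<close>. Soundness then follows by induction on derivations.
\<close>

abbreviation real_of_nnrat :: "nnrat \<Rightarrow> real" where
  "real_of_nnrat r \<equiv> of_rat (rat_of_nnrat r)"

lemma real_of_nnrat_zero: "real_of_nnrat 0 = 0"
  by (simp add: zero_nnrat.rep_eq)

lemma real_of_nnrat_add: "real_of_nnrat (r + q) = real_of_nnrat r + real_of_nnrat q"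
  by (simp add: plus_nnrat.rep_eq of_rat_add)

lemma real_of_nnrat_le_iff: "real_of_nnrat r \<le> real_of_nnrat q \<longleftrightarrow> r \<le> q"
  by (simp add: less_eq_nnrat.rep_eq of_rat_less_eq)

lemma real_of_nnrat_pos: "0 < r \<Longrightarrow> 0 < real_of_nnrat r"
  by (simp add: less_nnrat.rep_eq zero_nnrat.rep_eq)

lemma real_of_nnrat_min: "real_of_nnrat (min r q) = min (real_of_nnrat r) (real_of_nnrat q)"
  by (simp add: min_def real_of_nnrat_le_iff)

lemma real_of_nnrat_max: "real_of_nnrat (max r q) = max (real_of_nnrat r) (real_of_nnrat q)"
  by (simp add: max_def real_of_nnrat_le_iff)

text \<open>Since \<open>c\<close> is real, the default value -\<infinity> fails the inequality;
  this is where nonemptiness comes from.\<close>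

lemma theta_minus_ge_iff:
  "ereal c \<le> theta_minus \<M> s T \<longleftrightarrow> theta \<M> s T \<noteq> {} \<and> (\<forall>x\<in>theta \<M> s T. c \<le> x)"
  by (auto simp: theta_minus_def le_INF_iff)

lemma theta_plus_le_iff:
  "theta_plus \<M> s T \<le> ereal c \<longleftrightarrow> theta \<M> s T \<noteq> {} \<and> (\<forall>x\<in>theta \<M> s T. x \<le> c)"
  by (auto simp: theta_plus_def SUP_le_iff)

text \<open>A predicate on weights instead of a set, so that the modal cases become first-order
  goals.\<close>

definition step_to :: "('s, 'p) wts \<Rightarrow> 's \<Rightarrow> 'p form \<Rightarrow> real \<Rightarrow> bool" where
  "step_to \<M> s \<phi> x \<longleftrightarrow> (\<exists>t\<in>states \<M>. sat \<M> t \<phi> \<and> (s, x, t) \<in> transitions \<M>)"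

lemma mem_theta_sat_iff: "x \<in> theta \<M> s {t \<in> states \<M>. sat \<M> t \<phi>} \<longleftrightarrow> step_to \<M> s \<phi> x"
  by (auto simp: theta_def step_to_def)

lemma sat_L_iff:
  "sat \<M> s (L r \<phi>) \<longleftrightarrow>
     (\<exists>x. step_to \<M> s \<phi> x) \<and> (\<forall>x. step_to \<M> s \<phi> x \<longrightarrow> real_of_nnrat r \<le> x)"
  unfolding sat.simps ereal_of_nnrat_def theta_minus_ge_iff ex_in_conv[symmetric] Ball_def
    mem_theta_sat_iff ..

lemma sat_M_iff:
  "sat \<M> s (M r \<phi>) \<longleftrightarrow>
     (\<exists>x. step_to \<M> s \<phi> x) \<and> (\<forall>x. step_to \<M> s \<phi> x \<longrightarrow> x \<le> real_of_nnrat r)"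
  unfolding sat.simps ereal_of_nnrat_def theta_plus_le_iff ex_in_conv[symmetric] Ball_def
    mem_theta_sat_iff ..

lemma step_to_nonneg: "is_wts \<M> \<Longrightarrow> step_to \<M> s \<phi> x \<Longrightarrow> 0 \<le> x"
  by (auto simp: is_wts_def step_to_def)

lemma sat_L0_iff: "is_wts \<M> \<Longrightarrow> sat \<M> s (L 0 \<phi>) \<longleftrightarrow> (\<exists>x. step_to \<M> s \<phi> x)"
  unfolding sat_L_iff real_of_nnrat_zero by (auto dest: step_to_nonneg)

lemma sat_Bot: "\<not> sat \<M> s Bot"
  by (simp add: Bot_def)

lemma sat_Disj: "sat \<M> s (Disj \<phi> \<psi>) \<longleftrightarrow> sat \<M> s \<phi> \<or> sat \<M> s \<psi>"
  by (simp add: Disj_def)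

lemma sat_Imp: "sat \<M> s (Imp \<phi> \<psi>) \<longleftrightarrow> (sat \<M> s \<phi> \<longrightarrow> sat \<M> s \<psi>)"
  by (auto simp: Imp_def sat_Disj)

lemma step_to_Bot: "\<not> step_to \<M> s Bot x"
  by (simp add: step_to_def sat_Bot)

lemma step_to_Disj: "step_to \<M> s (Disj \<phi> \<psi>) x \<longleftrightarrow> step_to \<M> s \<phi> x \<or> step_to \<M> s \<psi> x"
  by (auto simp: step_to_def sat_Disj)

lemma step_to_mono:
  "(\<And>t. t \<in> states \<M> \<Longrightarrow> sat \<M> t (Imp \<phi> \<psi>)) \<Longrightarrow> step_to \<M> s \<phi> x \<Longrightarrow> step_to \<M> s \<psi> x"
  by (auto simp: step_to_def sat_Imp)

text \<open>At a fixed state, satisfaction is itself a valuation of the propositional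
  variables.\<close>

lemma sat_prop_subst: "sat \<M> s (prop_subst \<sigma> A) \<longleftrightarrow> prop_eval (\<lambda>i. sat \<M> s (\<sigma> i)) A"
  by (induction A) auto

text \<open>The model stays fixed but the state varies in the induction: R1, R1' and R2 use their
  premise at the targets of transitions.\<close>

lemma provable_sound:
  assumes "provable \<phi>" and wts: "is_wts \<M>" and "s \<in> states \<M>"
  shows "sat \<M> s \<phi>"
proof -
  txt \<open>To be unfolded in this order, since the modal clauses would also match \<open>L\<^sub>0\<close>.\<close>
  note sat_bool = sat_Imp sat_Disj sat.simps(2,3) sat_L0_iff[OF wts]
  note sat_modal = sat_L_iff sat_M_iff step_to_Disj
    real_of_nnrat_add real_of_nnrat_min real_of_nnrat_max min_le_iff_disj le_max_iff_disj
  show ?thesis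
    using assms(1,3)
  proof (induction arbitrary: s)
    case (Taut A \<sigma>)
    then show ?case by (simp add: sat_prop_subst tautology_def)
  next
    case A1
    show ?case by (simp add: sat_L0_iff[OF wts] step_to_Bot del: sat.simps(4))
  next
    case (A2 q r \<phi>)
    have "real_of_nnrat r \<le> x" if "real_of_nnrat r + real_of_nnrat q \<le> x" for x :: real
      using real_of_nnrat_pos[OF A2(1)] that by linarith
    then show ?case unfolding sat_bool unfolding sat_modal by blast
  next
    case (A2' q r \<phi>)
    have "x \<le> real_of_nnrat r + real_of_nnrat q" if "x \<le> real_of_nnrat r" for x :: real
      using real_of_nnrat_pos[OF A2'(1)] that by linarith
    then show ?case unfolding sat_bool unfolding sat_modal by blast
  next
    case (A3 r \<phi> q \<psi>)
    \<comment> \<open>A step to the disjunction reaches one disjunct, whose own bound is at least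
      the minimum.\<close>
    show ?case unfolding sat_bool unfolding sat_modal by blast
  next
    case (A3' r \<phi> q \<psi>)
    show ?case unfolding sat_bool unfolding sat_modal by blast
  next
    case (A4 r \<phi> \<psi>)
    \<comment> \<open>Some step reaches a disjunct, and all steps to that disjunct inherit the
      bound.\<close>
    show ?case unfolding sat_bool unfolding sat_modal by blast
  next
    case (A5 \<psi> r \<phi>)
    \<comment> \<open>No step reaches \<open>\<psi>\<close>, so the steps to the disjunction are
      those to \<open>\<phi>\<close>.\<close>
    show ?case unfolding sat_bool unfolding sat_modal by blast
  next
    case (A5' \<psi> r \<phi>)
    show ?case unfolding sat_bool unfolding sat_modal by blast
  next
    case (A6 q r \<phi>)
    \<comment> \<open>Applied to the step whose existence \<open>L\<close> guarantees; its weight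
      cannot meet both bounds as \<open>q > 0\<close>.\<close>
    have "\<not> x \<le> real_of_nnrat r" if "real_of_nnrat r + real_of_nnrat q \<le> x" for x :: real
      using real_of_nnrat_pos[OF A6(1)] that by linarith
    then show ?case unfolding sat_bool unfolding sat_modal by blast
  next
    case (A7 r \<phi>)
    show ?case unfolding sat_bool unfolding sat_modal by blast
  next
    case (MP \<phi> \<psi>)
    then show ?case by (simp only: sat_Imp)
  next
    case (R1 \<phi> \<psi> r)
    \<comment> \<open>The bound passes from \<open>\<psi>\<close> down to \<open>\<phi>\<close>, but
      existence of a step does not; \<open>L 0 \<phi>\<close> supplies it.\<close>
    have "step_to \<M> s \<psi> x" if "step_to \<M> s \<phi> x" for x
      using R1.IH that by (rule step_to_mono)
    then show ?case unfolding sat_bool unfolding sat_modal by blast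
  next
    case (R1' \<phi> \<psi> r)
    have "step_to \<M> s \<psi> x" if "step_to \<M> s \<phi> x" for x
      using R1'.IH that by (rule step_to_mono)
    then show ?case unfolding sat_bool unfolding sat_modal by blast
  next
    case (R2 \<phi> \<psi>)
    have "step_to \<M> s \<psi> x" if "step_to \<M> s \<phi> x" for x
      using R2.IH that by (rule step_to_mono)
    then show ?case unfolding sat_bool unfolding sat_modal by blast
  qed
qed

theorem theorem4p2:
  fixes \<phi> :: "'p::countable form"
  assumes "provable \<phi>"
  shows "valid TYPE('s) \<phi>"
  using provable_sound[OF assms] by (auto simp: valid_def satisfiable_def)

end
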